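(* Let $\Delta$ be a simplicial complex on the vertex set $[n]=\{1,\dots,n\}$, and fix real coefficients $(a_T)_{T\in\Delta}$. Let $\mathfrak{I}$ be a cone of cooperative games on $\Delta$ (i.e. a cone in $\mathbb{R}^{\Delta}$) containing all the carrier games $v_T$ and $\hat v_T$, $\emptyset\neq T\in\Delta$. Let $\phi=(\phi_1,\dots,\phi_n)$ be a group value on $\mathfrak{I}$ and assume that there are real numbers $p^i_T$ ($i\in[n]$, $T\in\operatorname{Lk}_\Delta(i)$) such that for each $i\in[n]$ and each $v\in\mathfrak{I}$, \[ \phi_i(v)=\sum_{T\in \operatorname{Lk}_\Delta(i)}p_T^i\left(v(T\cup i)-v(T)\right). \] Then $\phi$ satisfies the general efficiency axiom, i.e. $\sum_{i=1}^n\phi_i(v)=\sum_{T\in\Delta}a_T v(T)$ for every $v\in\mathfrak{I}$, if and only if for every $T\in\Delta$ that is not a facet of $\Delta$ \[ \sum_{i\in T}p^i_{T\setminus i}-\sum_{j:\,T\in \operatorname{Lk}_\Delta(j)}p_T^j=a_T, \] and for every facet $F$ of $\Delta$ \[ \sum_{i\in F}p^i_{F\setminus i}=a_F. \]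
   Context: A simplicial complex $\Delta$ on $[n]$ is a family of subsets of $[n]$ such that $T\in\Delta$ and $S\subseteq T$ imply $S\in\Delta$. A facet is an element of $\Delta$ maximal under inclusion. For a vertex $i$, the link is $\operatorname{Lk}_\Delta(i)=\{T\in\Delta:\ i\notin T,\ T\cup\{i\}\in\Delta\}$. A cooperative game on $\Delta$ is a function $v:\Delta\to\mathbb{R}$ with $v(\emptyset)=0$; these form the real vector space $\mathbb{R}^{\Delta}$. A group value on $\mathfrak{I}$ is a tuple of functions $\phi_i:\mathfrak{I}\to\mathbb{R}$, $i\in[n]$. For $T\in\Delta$ the carrier games are $v_T(S)=1$ if $T\subseteq S$ and $0$ otherwise, and $\hat v_T(S)=1$ if $T\subsetneq S$ and $0$ otherwise ($S\in\Delta$). Notation $T\cup i$, $T\setminus i$ means $T\cup\{i\}$, $T\setminus\{i\}$.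
   Formalization: The two coefficient conditions are required only for nonempty T and nonempty facets F; since v(∅)=0 for every game, efficiency says nothing about a_∅ and the "only if" direction fails at T=∅ (e.g. n=1, Δ={∅,{1}}, p^1_∅=a_{1}=1, a_∅=0). *)

theory Defs
  imports Complex_Main
begin

definition simplicial_complex_on :: "nat \<Rightarrow> nat set set \<Rightarrow> bool" where
  "simplicial_complex_on n \<Delta> \<longleftrightarrow>
     \<Delta> \<subseteq> Pow {1..n} \<and> (\<forall>T\<in>\<Delta>. \<forall>S. S \<subseteq> T \<longrightarrow> S \<in> \<Delta>)"

definition facet :: "nat set set \<Rightarrow> nat set \<Rightarrow> bool" where
  "facet \<Delta> F \<longleftrightarrow> F \<in> \<Delta> \<and> (\<forall>T\<in>\<Delta>. F \<subseteq> T \<longrightarrow> T = F)"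

definition link :: "nat set set \<Rightarrow> nat \<Rightarrow> nat set set" where
  "link \<Delta> i = {T \<in> \<Delta>. i \<notin> T \<and> T \<union> {i} \<in> \<Delta>}"

text \<open>A function on \<open>\<Delta>\<close> is represented by its extension by zero to all sets of natural
  numbers, so that equality and the vector space operations of games are those of functions.\<close>

type_synonym game = "nat set \<Rightarrow> real"

definition games :: "nat set set \<Rightarrow> game set" where
  "games \<Delta> = {v. v {} = 0 \<and> (\<forall>S. S \<notin> \<Delta> \<longrightarrow> v S = 0)}"

text \<open>The condition of the library predicate \<open>cone\<close>, which is not applicable here because
  function types are not an instance of \<open>real_vector\<close>. Closure under addition is not required,
  so convex cones are a special case.\<close>

definition cone_of_games :: "nat set set \<Rightarrow> game set \<Rightarrow> bool" where
  "cone_of_games \<Delta> \<II> \<longleftrightarrow>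
     \<II> \<subseteq> games \<Delta> \<and> (\<forall>v\<in>\<II>. \<forall>c\<ge>0. (\<lambda>S. c * v S) \<in> \<II>)"

definition carrier_game :: "nat set set \<Rightarrow> nat set \<Rightarrow> game" where
  "carrier_game \<Delta> T = (\<lambda>S. if S \<in> \<Delta> \<and> T \<subseteq> S then 1 else 0)"

definition strict_carrier_game :: "nat set set \<Rightarrow> nat set \<Rightarrow> game" where
  "strict_carrier_game \<Delta> T = (\<lambda>S. if S \<in> \<Delta> \<and> T \<subset> S then 1 else 0)"

definition general_efficiency ::
  "nat \<Rightarrow> nat set set \<Rightarrow> (nat set \<Rightarrow> real) \<Rightarrow> game set \<Rightarrow> (nat \<Rightarrow> game \<Rightarrow> real) \<Rightarrow> bool" where
  "general_efficiency n \<Delta> a \<II> \<phi> \<longleftrightarrow>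
     (\<forall>v\<in>\<II>. (\<Sum>i=1..n. \<phi> i v) = (\<Sum>T\<in>\<Delta>. a T * v T))"

end

theory Submission
  imports Defs
begin

text \<open>Collecting the coefficient of each \<open>v T\<close> turns the total value into a linear form
  \<open>\<Sum>T. c T * v T\<close>, and for a facet the sum over the link in \<open>c T\<close> is empty. Comparing with
  \<open>\<Sum>T. a T * v T\<close> on \<open>v\<^sub>T\<close> minus the strict carrier game of \<open>T\<close>, which is the indicator of
  \<open>T\<close>, isolates \<open>c T = a T\<close> for each nonempty \<open>T\<close>; the cone itself need not contain this
  difference, since both sides of the axiom are linear forms.\<close>

definition efficiency_coeff :: "nat \<Rightarrow> nat set set \<Rightarrow> (nat \<Rightarrow> nat set \<Rightarrow> real) \<Rightarrow> nat set \<Rightarrow> real" where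
  "efficiency_coeff n \<Delta> p T =
     (\<Sum>i\<in>T. p i (T - {i})) - (\<Sum>j\<in>{j\<in>{1..n}. T \<in> link \<Delta> j}. p j T)"

lemma finite_simplicial_complex_on:
  assumes "simplicial_complex_on n \<Delta>"
  shows "finite \<Delta>"
  using assms finite_subset[of \<Delta> "Pow {1..n}"] by (simp add: simplicial_complex_on_def)

text \<open>Adding and removing \<open>i\<close> are mutually inverse, and closure under subsets
  puts \<open>T - {i}\<close> back into \<Delta>. This lets a sum of terms in
  \<open>T \<union> {i}\<close> over the link be reindexed by the faces containing
  \<open>i\<close>.\<close>

lemma bij_betw_link_star:
  assumes "simplicial_complex_on n \<Delta>"
  shows "bij_betw (\<lambda>T. T \<union> {i}) (link \<Delta> i) {T \<in> \<Delta>. i \<in> T}"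
proof (rule bij_betw_byWitness[where f' = "\<lambda>T. T - {i}"])
  show "(\<lambda>T. T - {i}) ` {T \<in> \<Delta>. i \<in> T} \<subseteq> link \<Delta> i"
    using assms by (auto simp: link_def simplicial_complex_on_def insert_absorb)
qed (auto simp: link_def)

text \<open>Double counting: a face \<open>T\<close> occurs as the larger set of a marginal
  contribution once for each \<open>i \<in> T\<close>, with weight \<open>p i (T - {i})\<close>, and
  as the smaller set once for each \<open>j\<close> whose link contains it, with weight
  \<open>- p j T\<close>.\<close>

lemma sum_marginal_contributions:
  fixes v :: game
  assumes "simplicial_complex_on n \<Delta>"
  shows "(\<Sum>i=1..n. \<Sum>T\<in>link \<Delta> i. p i T * (v (T \<union> {i}) - v T)) =
         (\<Sum>T\<in>\<Delta>. efficiency_coeff n \<Delta> p T * v T)"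
proof -
  have fin: "finite \<Delta>"
    using assms by (rule finite_simplicial_complex_on)
  have star: "(\<Sum>T\<in>link \<Delta> i. p i T * v (T \<union> {i})) =
      (\<Sum>T\<in>{T \<in> \<Delta>. i \<in> T}. p i (T - {i}) * v T)" for i
  proof -
    \<comment> \<open>Since \<open>i \<notin> T\<close> on the link, the weight too can be written
      in terms of \<open>T \<union> {i}\<close>, which is the form the bijection needs.\<close>
    have "(\<Sum>T\<in>link \<Delta> i. p i T * v (T \<union> {i})) =
        (\<Sum>T\<in>link \<Delta> i. p i ((T \<union> {i}) - {i}) * v (T \<union> {i}))"
      by (rule sum.cong) (auto simp: link_def)
    also have "\<dots> = (\<Sum>T\<in>{T \<in> \<Delta>. i \<in> T}. p i (T - {i}) * v T)"
      by (rule sum.reindex_bij_betw[OF bij_betw_link_star[OF assms],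
            where g = "\<lambda>T. p i (T - {i}) * v T"])
    finally show ?thesis .
  qed
  have "(\<Sum>i=1..n. \<Sum>T\<in>link \<Delta> i. p i T * v (T \<union> {i})) =
      (\<Sum>T\<in>\<Delta>. \<Sum>i\<in>{i \<in> {1..n}. i \<in> T}. p i (T - {i}) * v T)"
    unfolding star by (rule sum.swap_restrict) (use fin in auto)
  also have "\<dots> = (\<Sum>T\<in>\<Delta>. (\<Sum>i\<in>T. p i (T - {i})) * v T)"
  proof (rule sum.cong)
    fix T assume "T \<in> \<Delta>"
    then have "T \<subseteq> {1..n}"
      using assms by (auto simp: simplicial_complex_on_def simp del: One_nat_def)
    then have "{i \<in> {1..n}. i \<in> T} = T"
      by blast
    then show "(\<Sum>i\<in>{i \<in> {1..n}. i \<in> T}. p i (T - {i}) * v T) = (\<Sum>i\<in>T. p i (T - {i})) * v T"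
      by (simp add: sum_distrib_right)
  qed simp
  finally have plus: "(\<Sum>i=1..n. \<Sum>T\<in>link \<Delta> i. p i T * v (T \<union> {i})) =
      (\<Sum>T\<in>\<Delta>. (\<Sum>i\<in>T. p i (T - {i})) * v T)" .
  \<comment> \<open>The link is presented as a subset of \<Delta> cut out by a condition on
    \<open>i\<close> and \<open>T\<close>, so that the two sums can be exchanged.\<close>
  have "(\<Sum>i=1..n. \<Sum>T\<in>link \<Delta> i. p i T * v T) =
      (\<Sum>i=1..n. \<Sum>T\<in>{T \<in> \<Delta>. T \<in> link \<Delta> i}. p i T * v T)"
    by (intro sum.cong) (auto simp: link_def)
  also have "\<dots> = (\<Sum>T\<in>\<Delta>. \<Sum>i\<in>{i \<in> {1..n}. T \<in> link \<Delta> i}. p i T * v T)"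
    by (rule sum.swap_restrict) (use fin in auto)
  finally have minus: "(\<Sum>i=1..n. \<Sum>T\<in>link \<Delta> i. p i T * v T) =
      (\<Sum>T\<in>\<Delta>. (\<Sum>j\<in>{j \<in> {1..n}. T \<in> link \<Delta> j}. p j T) * v T)"
    by (simp add: sum_distrib_right)
  show ?thesis
    using plus minus
    by (simp only: efficiency_coeff_def right_diff_distrib left_diff_distrib sum_subtractf)
qed

text \<open>A facet lies in no link: \<open>F \<union> {j} \<in> \<Delta>\<close> with
  \<open>j \<notin> F\<close> would contradict maximality.\<close>

lemma efficiency_coeff_facet:
  assumes "facet \<Delta> F"
  shows "efficiency_coeff n \<Delta> p F = (\<Sum>i\<in>F. p i (F - {i}))"
proof -
  have no_link: "{j \<in> {1..n}. F \<in> link \<Delta> j} = {}"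
    using assms by (auto simp: facet_def link_def)
  show ?thesis
    unfolding efficiency_coeff_def no_link by simp
qed

text \<open>The two sums stay separate because each is the value of a linear form at a game of the
  cone; the lemma serves both for the efficiency coefficients and for \<open>a\<close>.\<close>

lemma sum_carrier_game_diff:
  fixes f :: "nat set \<Rightarrow> real"
  assumes "finite \<Delta>" "T \<in> \<Delta>"
  shows "(\<Sum>S\<in>\<Delta>. f S * carrier_game \<Delta> T S) - (\<Sum>S\<in>\<Delta>. f S * strict_carrier_game \<Delta> T S) = f T"
proof -
  have "(\<Sum>S\<in>\<Delta>. f S * carrier_game \<Delta> T S) - (\<Sum>S\<in>\<Delta>. f S * strict_carrier_game \<Delta> T S) =
      (\<Sum>S\<in>\<Delta>. if S = T then f S else 0)"
    unfolding sum_subtractf[symmetric]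
    by (intro sum.cong) (auto simp: carrier_game_def strict_carrier_game_def)
  then show ?thesis
    using assms by simp
qed

theorem theorem2p1:
  fixes n :: nat
    and \<Delta> :: "nat set set"
    and a :: "nat set \<Rightarrow> real"
    and \<II> :: "game set"
    and \<phi> :: "nat \<Rightarrow> game \<Rightarrow> real"
    and p :: "nat \<Rightarrow> nat set \<Rightarrow> real"
  assumes "simplicial_complex_on n \<Delta>"
    and "cone_of_games \<Delta> \<II>"
    and "\<And>T. T \<in> \<Delta> \<Longrightarrow> T \<noteq> {} \<Longrightarrow> carrier_game \<Delta> T \<in> \<II>"
    and "\<And>T. T \<in> \<Delta> \<Longrightarrow> T \<noteq> {} \<Longrightarrow> strict_carrier_game \<Delta> T \<in> \<II>"
    and "\<And>i v. i \<in> {1..n} \<Longrightarrow> v \<in> \<II> \<Longrightarrow>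
           \<phi> i v = (\<Sum>T\<in>link \<Delta> i. p i T * (v (T \<union> {i}) - v T))"
  shows "general_efficiency n \<Delta> a \<II> \<phi> \<longleftrightarrow>
           (\<forall>T\<in>\<Delta>. T \<noteq> {} \<longrightarrow> \<not> facet \<Delta> T \<longrightarrow>
              (\<Sum>i\<in>T. p i (T - {i})) - (\<Sum>j\<in>{j\<in>{1..n}. T \<in> link \<Delta> j}. p j T) = a T) \<and>
           (\<forall>F. facet \<Delta> F \<longrightarrow> F \<noteq> {} \<longrightarrow> (\<Sum>i\<in>F. p i (F - {i})) = a F)"
proof -
  let ?c = "efficiency_coeff n \<Delta> p"
  have fin: "finite \<Delta>"
    using assms(1) by (rule finite_simplicial_complex_on)
  have total: "(\<Sum>i=1..n. \<phi> i v) = (\<Sum>T\<in>\<Delta>. ?c T * v T)" if "v \<in> \<II>" for v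
    using that assms(5) sum_marginal_contributions[OF assms(1), of p v] by simp
  have "general_efficiency n \<Delta> a \<II> \<phi> \<longleftrightarrow> (\<forall>T\<in>\<Delta>. T \<noteq> {} \<longrightarrow> ?c T = a T)"
  proof
    assume "general_efficiency n \<Delta> a \<II> \<phi>"
    then have eff: "(\<Sum>T\<in>\<Delta>. ?c T * v T) = (\<Sum>T\<in>\<Delta>. a T * v T)" if "v \<in> \<II>" for v
      using that total by (simp add: general_efficiency_def)
    show "\<forall>T\<in>\<Delta>. T \<noteq> {} \<longrightarrow> ?c T = a T"
    proof (intro ballI impI)
      fix T assume T: "T \<in> \<Delta>" "T \<noteq> {}"
      show "?c T = a T"
        using sum_carrier_game_diff[OF fin T(1), of ?c] sum_carrier_game_diff[OF fin T(1), of a]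
          eff[OF assms(3)[OF T]] eff[OF assms(4)[OF T]] by simp
    qed
  next
    assume coeff: "\<forall>T\<in>\<Delta>. T \<noteq> {} \<longrightarrow> ?c T = a T"
    have "(\<Sum>T\<in>\<Delta>. ?c T * v T) = (\<Sum>T\<in>\<Delta>. a T * v T)" if "v \<in> \<II>" for v
    proof (rule sum.cong)
      \<comment> \<open>The coefficients at the empty set may differ, but games vanish there, so its
        two terms agree.\<close>
      have "v {} = 0"
        using that assms(2) by (auto simp: cone_of_games_def games_def)
      then show "?c T * v T = a T * v T" if "T \<in> \<Delta>" for T
        using coeff that by (cases "T = {}") auto
    qed simp
    then show "general_efficiency n \<Delta> a \<II> \<phi>"
      using total by (simp add: general_efficiency_def)
  qed
  also have "\<dots> \<longleftrightarrow> (\<forall>T\<in>\<Delta>. T \<noteq> {} \<longrightarrow> \<not> facet \<Delta> T \<longrightarrow> ?c T = a T) \<and>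
      (\<forall>F. facet \<Delta> F \<longrightarrow> F \<noteq> {} \<longrightarrow> ?c F = a F)"
    using facet_def by blast
  also have "\<dots> \<longleftrightarrow> (\<forall>T\<in>\<Delta>. T \<noteq> {} \<longrightarrow> \<not> facet \<Delta> T \<longrightarrow> ?c T = a T) \<and>
      (\<forall>F. facet \<Delta> F \<longrightarrow> F \<noteq> {} \<longrightarrow> (\<Sum>i\<in>F. p i (F - {i})) = a F)"
    \<comment> \<open>The congruence rule supplies \<open>facet \<Delta> F\<close> as an assumption
      for the conditional rewrite.\<close>
    by (simp add: efficiency_coeff_facet cong: imp_cong)
  finally show ?thesis
    unfolding efficiency_coeff_def .
qed

end
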